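(* Let $X$ be a complex Hilbert space and suppose that $T\in\mathcal{B}(X)$ is a power-bounded operator such that $\sigma(T)\cap\mathbb{T}=\{1\}$. Suppose further that $m\colon(0,\pi]\to(0,\infty)$ is a continuous non-increasing function of reciprocally positive increase such that $\|R(e^{i\theta},T)\|\le m(|\theta|)$ for $0<|\theta|\le\pi$. Then $$\|T^n(I-T)\|=O\big(m^{-1}(n)\big),\quad n\to\infty.$$
   Context: $\mathcal{B}(X)$ is the algebra of bounded linear operators on $X$, $\sigma(T)$ is the spectrum of $T$, $\mathbb{T}=\{\lambda\in\mathbb{C}:|\lambda|=1\}$, and $R(\lambda,T)=(\lambda-T)^{-1}$ for $\lambda$ in the resolvent set of $T$. An operator $T\in\mathcal{B}(X)$ is power-bounded if $\sup_{n\ge0}\|T^n\|<\infty$. A function $m\colon(0,\pi]\to(0,\infty)$ has reciprocally positive increase if there exist constants $c\in(0,1]$, $\alpha>0$ and $\varepsilon_0\in(0,\pi]$ such that $\dfrac{m(t^{-1}\varepsilon)}{m(\varepsilon)}\ge ct^\alpha$ for all $t\ge1$ and $0<\varepsilon\le\varepsilon_0$. (In particular $m(\varepsilon)\to\infty$ as $\varepsilon\to0+$.) For a continuous non-increasing function $m\colon(0,\pi]\to(0,\infty)$ with $m(\varepsilon)\to\infty$ as $\varepsilon\to0+$, the right-inverse $m^{-1}$ is defined by $m^{-1}(s)=\inf\{\varepsilon\in(0,\pi]:m(\varepsilon)\le s\}$ for $s\ge m(\pi)$. (Thus $m^{-1}(n)$ is defined for all sufficiently large $n$.) *)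

theory Defs
  imports "HOL-Analysis.Analysis" "HOL-Library.Landau_Symbols"
begin

class complex_vector = real_vector +
  fixes scaleC :: "complex \<Rightarrow> 'a \<Rightarrow> 'a"  (infixr "*\<^sub>C" 75)
  assumes scaleR_scaleC: "r *\<^sub>R x = complex_of_real r *\<^sub>C x"
    and scaleC_add_right: "a *\<^sub>C (x + y) = a *\<^sub>C x + a *\<^sub>C y"
    and scaleC_add_left: "(a + b) *\<^sub>C x = a *\<^sub>C x + b *\<^sub>C x"
    and scaleC_scaleC: "a *\<^sub>C (b *\<^sub>C x) = (a * b) *\<^sub>C x"
    and scaleC_one: "1 *\<^sub>C x = x"

text \<open>
  The inner product is linear in the first argument. The real inner product of the
  superclass is its real part, so the norm and the topology of the superclass are the ones
  induced by the complex inner product.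
\<close>

class complex_inner = complex_vector + real_inner +
  fixes cinner :: "'a \<Rightarrow> 'a \<Rightarrow> complex"
  assumes cinner_commute: "cinner x y = cnj (cinner y x)"
    and cinner_add_left: "cinner (x + y) z = cinner x z + cinner y z"
    and cinner_scaleC_left: "cinner (a *\<^sub>C x) y = a * cinner x y"
    and inner_eq_Re_cinner: "inner x y = Re (cinner x y)"

class complex_hilbert_space = complex_inner + complete_space

instantiation complex :: complex_hilbert_space
begin

definition scaleC_complex :: "complex \<Rightarrow> complex \<Rightarrow> complex"
  where "scaleC_complex a x = a * x"

definition cinner_complex :: "complex \<Rightarrow> complex \<Rightarrow> complex"
  where "cinner_complex x y = x * cnj y"

instance
  by standard
    (simp_all add: scaleC_complex_def cinner_complex_def scaleR_conv_of_real inner_complex_def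
      algebra_simps)

end

definition bounded_clinear ::
  "('a :: complex_inner \<Rightarrow> 'b :: complex_inner) \<Rightarrow> bool"
  where "bounded_clinear T \<longleftrightarrow> bounded_linear T \<and> (\<forall>a x. T (a *\<^sub>C x) = a *\<^sub>C T x)"

definition resolvent_set :: "('a :: complex_inner \<Rightarrow> 'a) \<Rightarrow> complex set"
  where "resolvent_set T =
    {l. \<exists>S. bounded_clinear S \<and> S \<circ> (\<lambda>x. l *\<^sub>C x - T x) = id \<and> (\<lambda>x. l *\<^sub>C x - T x) \<circ> S = id}"

definition op_spectrum :: "('a :: complex_inner \<Rightarrow> 'a) \<Rightarrow> complex set"
  where "op_spectrum T = - resolvent_set T"

text \<open>Only meaningful for \<open>l\<close> in the resolvent set of \<open>T\<close>.\<close>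

definition resolvent :: "complex \<Rightarrow> ('a :: complex_inner \<Rightarrow> 'a) \<Rightarrow> 'a \<Rightarrow> 'a"
  where "resolvent l T = inv (\<lambda>x. l *\<^sub>C x - T x)"

definition power_bounded :: "('a :: complex_inner \<Rightarrow> 'a) \<Rightarrow> bool"
  where "power_bounded T \<longleftrightarrow> bdd_above (range (\<lambda>n. onorm (T ^^ n)))"

text \<open>
  Functions on \<open>(0, \<pi>]\<close> are represented by functions on the reals whose values outside
  this interval are ignored.
\<close>

definition reciprocally_positive_increase :: "(real \<Rightarrow> real) \<Rightarrow> bool"
  where "reciprocally_positive_increase m \<longleftrightarrow>
    (\<exists>c \<alpha> \<epsilon>\<^sub>0. 0 < c \<and> c \<le> 1 \<and> 0 < \<alpha> \<and> 0 < \<epsilon>\<^sub>0 \<and> \<epsilon>\<^sub>0 \<le> pi \<and>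
      (\<forall>t \<epsilon>. 1 \<le> t \<and> 0 < \<epsilon> \<and> \<epsilon> \<le> \<epsilon>\<^sub>0 \<longrightarrow> m (inverse t * \<epsilon>) / m \<epsilon> \<ge> c * t powr \<alpha>))"

text \<open>Only meaningful for \<open>s \<ge> m \<pi>\<close>: otherwise the set is empty.\<close>

definition right_inverse :: "(real \<Rightarrow> real) \<Rightarrow> real \<Rightarrow> real"
  where "right_inverse m s = Inf {\<epsilon> \<in> {0<..pi}. m \<epsilon> \<le> s}"

end

theory Submission
  imports Defs
begin

text \<open>
  Put \<open>w = x - T x\<close>, \<open>\<mu> = \<rho> e\<^bsup>i\<theta>\<^esup>\<close> with \<open>1 - \<rho> = 1 / (2n)\<close>, and let
  \<open>F\<^sub>p(\<mu>) x = (I - \<mu> T)\<^bsup>-(p + 1)\<^esup> x\<close>, whose \<open>j\<close>-th Taylor coefficient is \<open>(j + p choose p) T\<^sup>j x\<close>.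
  Power-boundedness gives \<open>\<parallel>T\<^sup>n w\<parallel> \<le> K \<parallel>T\<^sup>j w\<parallel>\<close> for \<open>j < n\<close>, so by Parseval \<open>n\<^bsup>2p + 1\<^esup> \<parallel>T\<^sup>n w\<parallel>\<^sup>2\<close> is
  at most a constant times the integral of \<open>\<parallel>F\<^sub>p(\<mu>) w\<parallel>\<^sup>2\<close>, while the integral of \<open>\<parallel>F\<^sub>0(\<mu>) x\<parallel>\<^sup>2\<close>
  is at most a constant times \<open>n \<parallel>x\<parallel>\<^sup>2\<close>. It remains to compare the integrands: since
  \<open>\<mu> F\<^sub>p(\<mu>) w = F\<^bsub>p - 1\<^esub>(\<mu>) x - (1 - \<mu>) F\<^sub>p(\<mu>) x\<close> and \<open>\<parallel>(I - \<mu> T)\<^bsup>-1\<^esup>\<parallel>\<close> is bounded by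
  multiples of both \<open>n\<close> and \<open>m(\<bar>\<theta>\<bar>)\<close>, one needs \<open>\<bar>\<theta>\<bar> min(n, m(\<bar>\<theta>\<bar>))\<^sup>p = O(\<epsilon> n\<^sup>p)\<close> whenever
  \<open>m(\<epsilon>) \<le> n\<close>. This is trivial for \<open>\<bar>\<theta>\<bar> \<le> \<epsilon>\<close> and follows from positive increase for
  \<open>\<bar>\<theta>\<bar> \<ge> \<epsilon>\<close> if \<open>p\<close> is large.
\<close>

section \<open>Norms of complex multiples\<close>

instance complex_hilbert_space \<subseteq> banach ..

lemma norm_scaleC: "norm (a *\<^sub>C x) = cmod a * norm (x :: 'a :: complex_inner)"
proof -
  have "cinner (a *\<^sub>C x) (a *\<^sub>C x) = a * cnj a * cinner x x"
    by (metis cinner_commute cinner_scaleC_left complex_cnj_mult mult.assoc mult.left_commute)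
  then have "(norm (a *\<^sub>C x))\<^sup>2 = (cmod a * norm x)\<^sup>2"
    by (simp add: power2_norm_eq_inner inner_eq_Re_cinner power_mult_distrib flip: complex_norm_square)
  then show ?thesis
    by simp
qed

lemma bounded_linear_scaleC: "bounded_linear (\<lambda>x :: 'a :: complex_inner. a *\<^sub>C x)"
  by (rule bounded_linear_intro[where K = "cmod a"])
     (simp_all add: scaleC_add_right scaleR_scaleC scaleC_scaleC norm_scaleC mult.commute)

lemma scaleC_diff_left: "(a - b) *\<^sub>C x = a *\<^sub>C x - b *\<^sub>C (x :: 'a :: complex_inner)"
  using scaleC_add_left[of "a - b" b x] by simp

lemma scaleC_zero_left: "0 *\<^sub>C x = (0 :: 'a :: complex_inner)"
  using scaleC_add_left[of 0 0 x] by simp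

lemma scaleC_sums:
  "f sums (s :: 'a :: complex_inner) \<Longrightarrow> (\<lambda>j. a *\<^sub>C f j) sums (a *\<^sub>C s)"
  by (rule bounded_linear.sums[OF bounded_linear_scaleC])

lemma inner_cis_scaleC:
  "inner (cis s *\<^sub>C a) (cis t *\<^sub>C b) = Re (cis (s - t) * cinner (a :: 'a :: complex_inner) b)"
proof -
  have "cinner (cis s *\<^sub>C a) (cis t *\<^sub>C b) = cis s * cnj (cis t) * cinner a b"
    by (metis cinner_commute cinner_scaleC_left complex_cnj_mult mult.assoc mult.left_commute complex_cnj_cnj)
  then show ?thesis
    by (simp add: inner_eq_Re_cinner cis_cnj cis_mult)
qed

section \<open>Exponentials on the circle and Parseval's identity\<close>

lemma has_integral_cis_int:
  fixes k :: int
  assumes "k \<noteq> 0"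
  shows "((\<lambda>t. cis (k * t)) has_integral 0) {-pi..pi}"
proof -
  have "((\<lambda>t. cis (k * t)) has_integral (cis (k * pi) / (\<i> * k) - cis (k * (- pi)) / (\<i> * k))) {-pi..pi}"
    using assms
    by (intro fundamental_theorem_of_calculus)
       (auto intro!: derivative_eq_intros simp: has_vector_derivative_def field_simps scaleR_conv_of_real)
  moreover have "cis (k * pi) = cis (k * (- pi))"
    by (auto simp: complex_eq_iff sin_zero_iff_int2)
  ultimately show ?thesis
    by simp
qed

lemma has_integral_inner_cis:
  fixes a b :: "'a :: complex_inner"
  assumes "j \<noteq> (k :: nat)"
  shows "((\<lambda>t. inner (cis (j * t) *\<^sub>C a) (cis (k * t) *\<^sub>C b)) has_integral 0) {-pi..pi}"
proof -
  have "((\<lambda>t. cis (real_of_int (int j - int k) * t)) has_integral 0) {-pi..pi}"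
    using assms by (intro has_integral_cis_int) simp
  moreover have "bounded_linear (\<lambda>z. Re (z * cinner a b))"
    by (rule bounded_linear_compose[OF bounded_linear_Re bounded_linear_mult_left])
  ultimately have "((\<lambda>z. Re (z * cinner a b)) \<circ> (\<lambda>t. cis (real_of_int (int j - int k) * t))
      has_integral Re (0 * cinner a b)) {-pi..pi}"
    by (rule has_integral_linear)
  then show ?thesis
    by (simp add: o_def inner_cis_scaleC left_diff_distrib del: times_complex.sel)
qed

lemma cmod_cis_diff_1_le: "cmod (cis t - 1) \<le> \<bar>t\<bar>"
  using dist_exp_i_1[of t] abs_sin_x_le_abs_x[of "t / 2"] by (simp add: cis_conv_exp mult.commute)

lemma cis_eq_1_imp_zero:
  assumes "\<bar>t\<bar> \<le> pi" "cis t = 1"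
  shows "t = 0"
  using assms dist_exp_i_1[of t] sin_zero_pi_iff[of "t / 2"] pi_gt_zero by (simp add: cis_conv_exp)

lemma summable_norm_square:
  assumes "summable (\<lambda>j. norm (a j))"
  shows "summable (\<lambda>j. (norm (a j))\<^sup>2)"
proof (rule summable_comparison_test[OF _ summable_mult[OF assms, of "\<Sum>j. norm (a j)"]], intro exI allI impI)
  show "norm ((norm (a j))\<^sup>2) \<le> (\<Sum>j. norm (a j)) * norm (a j)" for j
    using sum_le_suminf[OF assms, of "{j}"] by (simp add: mult_right_mono power2_eq_square)
qed

lemma norm_cis_scaleC: "norm (cis t *\<^sub>C x) = norm (x :: 'a :: complex_inner)"
  by (simp add: norm_scaleC)

text \<open>Adding the term of index \<open>J\<close> creates cross terms with the earlier terms
  only; each involves two distinct frequencies and so integrates to 0.\<close>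

lemma parseval_sum:
  fixes a :: "nat \<Rightarrow> 'a :: complex_inner"
  shows "((\<lambda>t. (norm (\<Sum>j<J. cis (j * t) *\<^sub>C a j))\<^sup>2) has_integral
    2 * pi * (\<Sum>j<J. (norm (a j))\<^sup>2)) {-pi..pi}"
proof (induction J)
  case (Suc J)
  have "((\<lambda>t. \<Sum>j<J. inner (cis (j * t) *\<^sub>C a j) (cis (J * t) *\<^sub>C a J)) has_integral (\<Sum>j<J. 0)) {-pi..pi}"
    by (intro has_integral_sum has_integral_inner_cis) auto
  then have cross: "((\<lambda>t. 2 * (\<Sum>j<J. inner (cis (j * t) *\<^sub>C a j) (cis (J * t) *\<^sub>C a J))) has_integral 0) {-pi..pi}"
    by (auto dest: has_integral_mult_right[where c = 2])
  have const: "((\<lambda>t. (norm (a J))\<^sup>2) has_integral 2 * pi * (norm (a J))\<^sup>2) {-pi..pi}"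
    using has_integral_const_real[of "(norm (a J))\<^sup>2" "- pi" pi] by simp
  have "(norm (\<Sum>j<Suc J. cis (j * t) *\<^sub>C a j))\<^sup>2 = (norm (\<Sum>j<J. cis (j * t) *\<^sub>C a j))\<^sup>2 + (norm (a J))\<^sup>2
     + 2 * (\<Sum>j<J. inner (cis (j * t) *\<^sub>C a j) (cis (J * t) *\<^sub>C a J))" for t :: real
    using dot_norm[of "\<Sum>j<J. cis (j * t) *\<^sub>C a j" "cis (J * t) *\<^sub>C a J"]
    by (simp add: inner_sum_left norm_cis_scaleC field_simps)
  with has_integral_add[OF has_integral_add[OF Suc const] cross] show ?case
    by (simp add: distrib_left)
qed simp

text \<open>Absolute summability makes the square of the sum of the norms a constant majorant of the
  squared norms of all partial sums, so dominated convergence passes to the limit in the finite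
  identity.\<close>

theorem parseval:
  fixes a :: "nat \<Rightarrow> 'a :: complex_hilbert_space"
  assumes "summable (\<lambda>j. norm (a j))"
  shows "((\<lambda>t. (norm (\<Sum>j. cis (j * t) *\<^sub>C a j))\<^sup>2) has_integral
    2 * pi * (\<Sum>j. (norm (a j))\<^sup>2)) {-pi..pi}"
proof -
  define G where "G J t = (norm (\<Sum>j<J. cis (real j * t) *\<^sub>C a j))\<^sup>2" for J t
  define g where "g t = (norm (\<Sum>j. cis (real j * t) *\<^sub>C a j))\<^sup>2" for t
  have int: "(G J has_integral 2 * pi * (\<Sum>j<J. (norm (a j))\<^sup>2)) {-pi..pi}" for J
    unfolding G_def by (rule parseval_sum)
  have bound: "norm (G J t) \<le> (\<Sum>j. norm (a j))\<^sup>2" for J t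
  proof -
    have "norm (\<Sum>j<J. cis (real j * t) *\<^sub>C a j) \<le> (\<Sum>j<J. norm (a j))"
      by (rule order_trans[OF norm_sum]) (simp add: norm_cis_scaleC)
    also have "\<dots> \<le> (\<Sum>j. norm (a j))"
      using assms by (intro sum_le_suminf) auto
    finally show ?thesis
      by (auto simp: G_def intro!: power_mono)
  qed
  have lim: "(\<lambda>J. G J t) \<longlonglongrightarrow> g t" for t
  proof -
    have "summable (\<lambda>j. cis (real j * t) *\<^sub>C a j)"
      using assms by (intro summable_norm_cancel[of "\<lambda>j. cis (real j * t) *\<^sub>C a j"]) (simp add: norm_cis_scaleC)
    then show ?thesis
      unfolding G_def g_def by (intro tendsto_intros summable_LIMSEQ)
  qed
  have G: "G J integrable_on {-pi..pi}" for J
    using int by blast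
  note conv = dominated_convergence[where h = "\<lambda>_. (\<Sum>j. norm (a j))\<^sup>2",
      OF G integrable_const_ivl bound lim]
  have "(\<lambda>J. 2 * pi * (\<Sum>j<J. (norm (a j))\<^sup>2)) \<longlonglongrightarrow> 2 * pi * (\<Sum>j. (norm (a j))\<^sup>2)"
    by (intro tendsto_intros summable_LIMSEQ summable_norm_square assms)
  then have "integral {-pi..pi} g = 2 * pi * (\<Sum>j. (norm (a j))\<^sup>2)"
    using conv(2) int[THEN integral_unique] by (simp add: LIMSEQ_unique)
  with conv(1) show ?thesis
    unfolding g_def by (simp add: has_integral_integrable_integral)
qed

section \<open>Binomial coefficients and power series\<close>

text \<open>A series rather than an iterated inverse, so that Parseval reads off its coefficients
  directly. That it inverts powers of I - \<mu> T is recovered in \<open>resolvent_series_0\<close>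
  and \<open>resolvent_series_Suc\<close>.\<close>

definition resolvent_series :: "('a :: complex_hilbert_space \<Rightarrow> 'a) \<Rightarrow> nat \<Rightarrow> complex \<Rightarrow> 'a \<Rightarrow> 'a"
  where "resolvent_series T p \<mu> x = (\<Sum>j. (of_nat (j + p choose p) * \<mu> ^ j) *\<^sub>C (T ^^ j) x)"

text \<open>Negating the upper index turns this into the binomial series with exponent
  \<open>- (p + 1)\<close>, evaluated at \<open>- x\<close>.\<close>

lemma summable_choose_power:
  assumes "\<bar>x\<bar> < (1 :: real)"
  shows "summable (\<lambda>j. real (j + p choose p) * x ^ j)"
proof -
  have "real (j + p choose p) = (- 1) ^ j * ((- (real p + 1)) gchoose j)" for j
    using gbinomial_negated_upper[of "- (real p + 1)" j] binomial_symmetric[of p "j + p"]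
    by (simp add: binomial_gbinomial)
  then have "real (j + p choose p) * x ^ j = ((- (real p + 1)) gchoose j) * (- x) ^ j" for j
    by (simp only: power_minus[of x] mult_ac)
  moreover have "summable (\<lambda>j. ((- (real p + 1)) gchoose j) * (- x) ^ j)"
    using gen_binomial_real[of "- x" "- (real p + 1)"] assms by (auto simp: sums_iff)
  ultimately show ?thesis
    by (simp only:)
qed

text \<open>A discrete version of integrating \<open>t ^ q\<close> from 0 to \<open>n\<close>: the
  increment of the left side is a sum of \<open>q + 1\<close> products, each at most
  \<open>(n + 1) ^ q\<close>.\<close>

lemma sum_powers_ge: "real n ^ Suc q \<le> real (Suc q) * (\<Sum>j<n. real (Suc j) ^ q)"
proof (induction n)
  case (Suc n)
  have "real (Suc n) ^ Suc q - real n ^ Suc q = (\<Sum>i<Suc q. real n ^ (q - i) * real (Suc n) ^ i)"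
    using power_diff_sumr2[of "real (Suc n)" "Suc q" "real n"] by (simp del: sum.lessThan_Suc)
  also have "\<dots> \<le> (\<Sum>i<Suc q. real (Suc n) ^ q)"
  proof (rule sum_mono)
    fix i assume "i \<in> {..<Suc q}"
    then have "real (Suc n) ^ q = real (Suc n) ^ (q - i) * real (Suc n) ^ i"
      by (simp flip: power_add)
    then show "real n ^ (q - i) * real (Suc n) ^ i \<le> real (Suc n) ^ q"
      by (simp add: mult_right_mono power_mono)
  qed
  finally show ?case
    using Suc by (simp add: distrib_left)
qed simp

text \<open>The binomial coefficient is the rising product of j + 1, ..., j + p divided by
  \<open>fact p\<close>, and each factor is at least j + 1.\<close>

lemma choose_ge: "real (Suc j) ^ p \<le> fact p * real (j + p choose p)"
proof -
  have "real (Suc j) ^ p = (\<Prod>i<p. real (Suc j))"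
    by simp
  also have "\<dots> \<le> (\<Prod>i<p. real (Suc j) + real i)"
    by (intro prod_mono) auto
  also have "\<dots> = pochhammer (real (Suc j)) p"
    by (simp add: pochhammer_prod lessThan_atLeast0)
  also have "\<dots> = fact p * real (j + p choose p)"
    by (simp add: binomial_gbinomial gbinomial_pochhammer' add.commute[of 1])
  finally show ?thesis .
qed

section \<open>Algebra of the resolvent series of a power-bounded operator\<close>

context
  fixes T :: "'a :: complex_hilbert_space \<Rightarrow> 'a" and K :: real
  assumes T: "bounded_clinear T"
    and norm_power_le: "\<And>j x. norm ((T ^^ j) x) \<le> K * norm x"
    and K: "1 \<le> K"
begin

lemma linear_T: "bounded_linear T" and T_scaleC: "T (a *\<^sub>C x) = a *\<^sub>C T x"
  using T by (auto simp: bounded_clinear_def)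

lemma power_linear: "linear (T ^^ j)"
  using linear_T by (induction j) (auto simp: linear_compose bounded_linear.linear linear_id)

lemma summable_resolvent_series_norm:
  assumes "cmod \<mu> < 1"
  shows "summable (\<lambda>j. norm ((of_nat (j + p choose p) * \<mu> ^ j) *\<^sub>C (T ^^ j) x))"
proof (rule summable_comparison_test[OF exI summable_mult2[OF summable_choose_power, where c = "K * norm x"]], intro allI impI)
  show "\<bar>cmod \<mu>\<bar> < 1"
    using assms by simp
  show "norm (norm ((of_nat (j + p choose p) * \<mu> ^ j) *\<^sub>C (T ^^ j) x))
      \<le> real (j + p choose p) * cmod \<mu> ^ j * (K * norm x)" for j
    by (simp add: norm_scaleC norm_mult norm_power mult_left_mono norm_power_le)
qed

lemma resolvent_series_sums:
  assumes "cmod \<mu> < 1"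
  shows "(\<lambda>j. (of_nat (j + p choose p) * \<mu> ^ j) *\<^sub>C (T ^^ j) x) sums resolvent_series T p \<mu> x"
  unfolding resolvent_series_def
  by (rule summable_sums[OF summable_norm_cancel[OF summable_resolvent_series_norm[OF assms]]])

lemma resolvent_series_diff:
  assumes "cmod \<mu> < 1"
  shows "resolvent_series T p \<mu> (x - y) = resolvent_series T p \<mu> x - resolvent_series T p \<mu> y"
proof (rule sums_unique2[OF resolvent_series_sums[OF assms]])
  have "c *\<^sub>C (T ^^ j) (x - y) = c *\<^sub>C (T ^^ j) x - c *\<^sub>C (T ^^ j) y" for c j
    by (simp add: linear_diff[OF power_linear] linear_diff[OF bounded_linear.linear[OF bounded_linear_scaleC]])
  then show "(\<lambda>j. (of_nat (j + p choose p) * \<mu> ^ j) *\<^sub>C (T ^^ j) (x - y)) sums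
     (resolvent_series T p \<mu> x - resolvent_series T p \<mu> y)"
    using sums_diff[OF resolvent_series_sums resolvent_series_sums, OF assms assms] by simp
qed

lemma T_resolvent_series_sums:
  assumes "cmod \<mu> < 1"
  shows "(\<lambda>j. (of_nat (j + p choose p) * \<mu> ^ j) *\<^sub>C (T ^^ Suc j) x) sums T (resolvent_series T p \<mu> x)"
  using bounded_linear.sums[OF linear_T resolvent_series_sums[OF assms]] by (simp add: T_scaleC)

lemma resolvent_series_T:
  assumes "cmod \<mu> < 1"
  shows "resolvent_series T p \<mu> (T x) = T (resolvent_series T p \<mu> x)"
  using resolvent_series_sums[OF assms, of p "T x"] T_resolvent_series_sums[OF assms, of p x]
  by (auto simp: funpow_swap1 intro: sums_unique2)

lemma resolvent_series_scaleC:
  assumes "cmod \<mu> < 1"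
  shows "resolvent_series T p \<mu> (a *\<^sub>C x) = a *\<^sub>C resolvent_series T p \<mu> x"
proof (rule sums_unique2[OF resolvent_series_sums[OF assms]])
  have "(T ^^ j) (a *\<^sub>C x) = a *\<^sub>C (T ^^ j) x" for j
    by (induction j) (auto simp: T_scaleC)
  then show "(\<lambda>j. (of_nat (j + p choose p) * \<mu> ^ j) *\<^sub>C (T ^^ j) (a *\<^sub>C x)) sums
      (a *\<^sub>C resolvent_series T p \<mu> x)"
    using scaleC_sums[OF resolvent_series_sums[OF assms], of a p x] by (simp add: scaleC_scaleC ac_simps)
qed

text \<open>Applying \<mu> T moves every coefficient up by one index. The explicit 0 at index 0
  aligns this series with the original one for termwise subtraction.\<close>

lemma shifted_resolvent_series_sums:
  assumes "cmod \<mu> < 1"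
  shows "(\<lambda>j. (case j of 0 \<Rightarrow> 0 | Suc i \<Rightarrow> of_nat (i + p choose p) * \<mu> ^ j) *\<^sub>C (T ^^ j) x)
    sums (\<mu> *\<^sub>C T (resolvent_series T p \<mu> x))" (is "?f sums _")
proof -
  have "(\<lambda>j. ?f (Suc j)) sums (\<mu> *\<^sub>C T (resolvent_series T p \<mu> x))"
    using scaleC_sums[OF T_resolvent_series_sums[OF assms], of \<mu> p x]
    by (simp add: scaleC_scaleC ac_simps)
  from sums_Suc[OF this] show ?thesis
    by (simp add: scaleC_zero_left)
qed

lemma resolvent_series_diff_shift_sums:
  assumes "cmod \<mu> < 1"
  shows "(\<lambda>j. (of_nat (j + p choose p) * \<mu> ^ j
      - (case j of 0 \<Rightarrow> 0 | Suc i \<Rightarrow> of_nat (i + p choose p) * \<mu> ^ j)) *\<^sub>C (T ^^ j) x)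
    sums (resolvent_series T p \<mu> x - \<mu> *\<^sub>C T (resolvent_series T p \<mu> x))"
  unfolding scaleC_diff_left
  by (rule sums_diff[OF resolvent_series_sums[OF assms] shifted_resolvent_series_sums[OF assms]])

text \<open>For \<open>p = 0\<close> both series have the same coefficient at every positive index,
  so only the term of index 0 survives.\<close>

lemma resolvent_series_0:
  assumes "cmod \<mu> < 1"
  shows "resolvent_series T 0 \<mu> x - \<mu> *\<^sub>C T (resolvent_series T 0 \<mu> x) = x"
proof -
  have "(of_nat (j + 0 choose 0) * \<mu> ^ j
      - (case j of 0 \<Rightarrow> 0 | Suc i \<Rightarrow> of_nat (i + 0 choose 0) * \<mu> ^ j)) *\<^sub>C (T ^^ j) x
      = (if j = 0 then x else 0)" for j
    by (cases j) (simp_all add: scaleC_zero_left scaleC_one)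
  then have "(\<lambda>j. if j = 0 then x else 0)
      sums (resolvent_series T 0 \<mu> x - \<mu> *\<^sub>C T (resolvent_series T 0 \<mu> x))"
    using resolvent_series_diff_shift_sums[OF assms, of 0 x] by (simp only:)
  then show ?thesis
    by (rule sums_unique2[OF _ sums_single])
qed

text \<open>Pascal's rule, applied coefficientwise. Raising \<open>p\<close> by one thus amounts to
  one more application of the inverse of I - \<mu> T.\<close>

lemma resolvent_series_Suc:
  assumes "cmod \<mu> < 1"
  shows "resolvent_series T (Suc p) \<mu> x - \<mu> *\<^sub>C T (resolvent_series T (Suc p) \<mu> x)
    = resolvent_series T p \<mu> x"
proof -
  have "of_nat (j + Suc p choose Suc p) * \<mu> ^ j
      - (case j of 0 \<Rightarrow> 0 | Suc i \<Rightarrow> of_nat (i + Suc p choose Suc p) * \<mu> ^ j)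
      = of_nat (j + p choose p) * \<mu> ^ j" for j
    by (cases j) (simp_all add: distrib_right del: power_Suc)
  then have "(\<lambda>j. (of_nat (j + p choose p) * \<mu> ^ j) *\<^sub>C (T ^^ j) x)
      sums (resolvent_series T (Suc p) \<mu> x - \<mu> *\<^sub>C T (resolvent_series T (Suc p) \<mu> x))"
    using resolvent_series_diff_shift_sums[OF assms, of "Suc p" x] by (simp only:)
  then show ?thesis
    by (rule sums_unique2[OF _ resolvent_series_sums[OF assms]])
qed

section \<open>Lower bounds for I - \<mu> T and estimates of the series\<close>

lemma norm_resolvent_series_0_le:
  assumes "cmod \<mu> < 1"
  shows "norm (resolvent_series T 0 \<mu> x) \<le> K / (1 - cmod \<mu>) * norm x"
proof -
  have "norm (resolvent_series T 0 \<mu> x) \<le> (\<Sum>j. norm ((of_nat (j + 0 choose 0) * \<mu> ^ j) *\<^sub>C (T ^^ j) x))"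
    unfolding resolvent_series_def by (intro summable_norm summable_resolvent_series_norm assms)
  also have "\<dots> \<le> (\<Sum>j. cmod \<mu> ^ j * (K * norm x))"
    using assms summable_resolvent_series_norm[OF assms, of 0 x]
    by (intro suminf_le summable_mult2 summable_geometric)
       (auto simp: norm_scaleC norm_power mult_left_mono norm_power_le)
  also have "\<dots> = K / (1 - cmod \<mu>) * norm x"
    using assms by (subst suminf_mult2[symmetric]) (auto simp: suminf_geometric)
  finally show ?thesis .
qed

text \<open>The series with \<open>p = 0\<close> commutes with \<open>T\<close> and is therefore
  also a left inverse. Phrasing inverse bounds as lower bounds lets them be applied to values of
  \<open>resolvent_series\<close> without naming an inverse.\<close>

lemma norm_le_one_minus:
  assumes "cmod \<mu> < 1"
  shows "norm x \<le> K / (1 - cmod \<mu>) * norm (x - \<mu> *\<^sub>C T x)"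
proof -
  have "resolvent_series T 0 \<mu> (x - \<mu> *\<^sub>C T x) = x"
    using assms
    by (simp add: resolvent_series_diff resolvent_series_scaleC resolvent_series_T resolvent_series_0)
  then show ?thesis
    using norm_resolvent_series_0_le[OF assms] by metis
qed

text \<open>
  The distance \<open>1 - \<rho>\<close> to the unit circle is either small compared with \<open>1 / M\<close>, and then the bound
  on the circle survives the perturbation, or it is at least of that order, and then the bound by
  power-boundedness suffices.
\<close>

lemma norm_le_one_minus_boundary:
  assumes \<omega>: "cmod \<omega> = 1" and M: "0 < M" "\<And>w. norm w \<le> M * norm (w - \<omega> *\<^sub>C T w)"
    and \<rho>: "0 \<le> \<rho>" "\<rho> < 1"
  shows "norm w \<le> 2 * K\<^sup>2 * M * norm (w - (of_real \<rho> * \<omega>) *\<^sub>C T w)" (is "_ \<le> _ * norm ?v")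
proof (cases "2 * K * M * (1 - \<rho>) \<le> 1")
  case True
  have "w - \<omega> *\<^sub>C T w = ?v - (of_real (1 - \<rho>) * \<omega>) *\<^sub>C T w"
    by (simp add: scaleC_diff_left left_diff_distrib)
  then have "norm (w - \<omega> *\<^sub>C T w) \<le> norm ?v + norm ((of_real (1 - \<rho>) * \<omega>) *\<^sub>C T w)"
    by (simp only: norm_triangle_ineq4)
  also have "norm ((of_real (1 - \<rho>) * \<omega>) *\<^sub>C T w) \<le> (1 - \<rho>) * (K * norm w)"
    using norm_power_le[of 1 w] \<omega> \<rho>
    by (simp add: norm_scaleC norm_mult mult_left_mono del: of_real_diff)
  finally have "norm (w - \<omega> *\<^sub>C T w) \<le> norm ?v + (1 - \<rho>) * (K * norm w)"
    by simp
  then have "norm w \<le> M * (norm ?v + (1 - \<rho>) * (K * norm w))"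
    by (meson M order_trans mult_left_mono less_imp_le)
  \<comment> \<open>By the case assumption the perturbation costs at most half of
    \<open>norm w\<close>; this is absorbed on the left and doubles the constant.\<close>
  moreover have "M * ((1 - \<rho>) * (K * norm w)) \<le> norm w / 2"
    using mult_right_mono[OF True, of "norm w / 2"] by (simp add: algebra_simps)
  ultimately have "norm w \<le> 2 * M * norm ?v"
    by (simp add: distrib_left)
  also have "\<dots> \<le> 2 * M * norm ?v * K\<^sup>2"
    using K M(1) mult_left_mono[of 1 "K\<^sup>2" "2 * M * norm ?v"] by (simp add: one_le_power)
  finally show ?thesis
    by (simp add: ac_simps)
next
  case False
  then have "K / (1 - \<rho>) \<le> 2 * K\<^sup>2 * M"
    using K M \<rho> mult_left_mono[of 1 "2 * K * M * (1 - \<rho>)" K]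
    by (simp add: pos_divide_le_eq power2_eq_square mult_ac)
  moreover have "norm w \<le> K / (1 - \<rho>) * norm ?v"
    using norm_le_one_minus[of "of_real \<rho> * \<omega>" w] \<omega> \<rho> by (simp add: norm_mult)
  ultimately show ?thesis
    by (meson order_trans mult_right_mono norm_ge_zero)
qed

text \<open>Each inverse factor costs \<open>q\<close>. The series with \<open>p = 0\<close> is left
  unestimated because Parseval bounds its mean square better than a pointwise estimate
  would.\<close>

lemma norm_resolvent_series_le_power:
  assumes "cmod \<mu> < 1" "0 \<le> q" "\<And>w. norm w \<le> q * norm (w - \<mu> *\<^sub>C T w)"
  shows "norm (resolvent_series T p \<mu> x) \<le> q ^ p * norm (resolvent_series T 0 \<mu> x)"
proof (induction p)
  case (Suc p)
  have "norm (resolvent_series T (Suc p) \<mu> x) \<le> q * norm (resolvent_series T p \<mu> x)"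
    using assms(3)[of "resolvent_series T (Suc p) \<mu> x"] by (simp add: resolvent_series_Suc assms(1))
  then show ?case
    using mult_left_mono[OF Suc assms(2)] by simp
qed simp

text \<open>In \<open>\<mu> (I - T) = (I - \<mu> T) - (1 - \<mu>) I\<close> the first summand
  cancels one inverse factor, and the second carries 1 - \<mu>, which is small near the spectral
  point 1.\<close>

lemma norm_resolvent_series_diff_le:
  assumes "cmod \<mu> < 1" "0 \<le> q" "\<And>w. norm w \<le> q * norm (w - \<mu> *\<^sub>C T w)"
  shows "cmod \<mu> * norm (resolvent_series T (Suc p) \<mu> (x - T x))
    \<le> (q ^ p + cmod (1 - \<mu>) * q ^ Suc p) * norm (resolvent_series T 0 \<mu> x)"
proof -
  let ?F = "\<lambda>p. resolvent_series T p \<mu> x"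
  have "\<mu> *\<^sub>C resolvent_series T (Suc p) \<mu> (x - T x)
      = \<mu> *\<^sub>C ?F (Suc p) - \<mu> *\<^sub>C T (?F (Suc p))"
    by (simp add: resolvent_series_diff resolvent_series_T assms(1)
        linear_diff[OF bounded_linear.linear[OF bounded_linear_scaleC]])
  also have "\<dots> = ?F p - (1 - \<mu>) *\<^sub>C ?F (Suc p)"
    using resolvent_series_Suc[OF assms(1), of p x] by (simp add: scaleC_diff_left scaleC_one algebra_simps)
  finally have "cmod \<mu> * norm (resolvent_series T (Suc p) \<mu> (x - T x))
      \<le> norm (?F p) + cmod (1 - \<mu>) * norm (?F (Suc p))"
    using norm_triangle_ineq4[of "?F p" "(1 - \<mu>) *\<^sub>C ?F (Suc p)"] by (metis norm_scaleC)
  also have "\<dots> \<le> q ^ p * norm (?F 0) + cmod (1 - \<mu>) * (q ^ Suc p * norm (?F 0))"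
    by (intro add_mono mult_left_mono norm_resolvent_series_le_power assms) auto
  finally show ?thesis
    by (simp add: algebra_simps)
qed

section \<open>From mean squares on a circle to a single power\<close>

lemma resolvent_series_parseval:
  assumes "0 \<le> \<rho>" "\<rho> < 1"
  shows "((\<lambda>t. (norm (resolvent_series T p (of_real \<rho> * cis t) x))\<^sup>2) has_integral
    2 * pi * (\<Sum>j. (real (j + p choose p) * \<rho> ^ j * norm ((T ^^ j) x))\<^sup>2)) {-pi..pi}"
    and "summable (\<lambda>j. (real (j + p choose p) * \<rho> ^ j * norm ((T ^^ j) x))\<^sup>2)"
proof -
  define a where "a j = of_real (real (j + p choose p) * \<rho> ^ j) *\<^sub>C (T ^^ j) x" for j
  have norm_a: "norm (a j) = real (j + p choose p) * \<rho> ^ j * norm ((T ^^ j) x)" for j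
    using assms by (simp add: a_def norm_scaleC norm_mult norm_power)
  have a: "summable (\<lambda>j. norm (a j))"
    using summable_resolvent_series_norm[of "of_real \<rho>" p x] assms by (simp add: a_def)
  have "of_nat (j + p choose p) * (of_real \<rho> * cis t) ^ j
      = cis (j * t) * of_real (real (j + p choose p) * \<rho> ^ j)" for j t
    by (simp only: power_mult_distrib Complex.DeMoivre of_real_mult of_real_of_nat_eq of_real_power mult_ac)
  then have "resolvent_series T p (of_real \<rho> * cis t) x = (\<Sum>j. cis (j * t) *\<^sub>C a j)" for t :: real
    by (simp only: resolvent_series_def a_def scaleC_scaleC)
  with parseval[OF a] show "((\<lambda>t. (norm (resolvent_series T p (of_real \<rho> * cis t) x))\<^sup>2) has_integral
    2 * pi * (\<Sum>j. (real (j + p choose p) * \<rho> ^ j * norm ((T ^^ j) x))\<^sup>2)) {-pi..pi}"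
    by (simp add: norm_a)
  show "summable (\<lambda>j. (real (j + p choose p) * \<rho> ^ j * norm ((T ^^ j) x))\<^sup>2)"
    using summable_norm_square[OF a] by (simp add: norm_a)
qed

text \<open>Parseval turns the pointwise comparison into one of square sums. The radius balances
  both sides: \<open>\<rho> ^ n \<ge> 1 / 2\<close> preserves the first \<open>n\<close>
  coefficients on the left, and \<open>1 / (1 - \<rho>) = 2 n\<close> keeps the sum for
  \<open>x\<close> of order \<open>n\<close>. Both sides then contain \<open>n ^ (2 p + 1)\<close>,
  which cancels.\<close>

lemma norm_power_le_of_resolvent_series_le:
  assumes n: "1 \<le> n" and \<rho>: "\<rho> = 1 - 1 / (2 * real n)" and B: "0 \<le> B"
    and le: "\<And>t. t \<in> {-pi..pi} \<Longrightarrow> norm (resolvent_series T p (of_real \<rho> * cis t) y)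
      \<le> B * real n ^ p * norm (resolvent_series T 0 (of_real \<rho> * cis t) x)"
  shows "norm ((T ^^ n) y) \<le> 4 * real (2 * p + 1) * fact p * K\<^sup>2 * B * norm x"
proof -
  have \<rho>01: "0 \<le> \<rho>" "\<rho> < 1"
    using n by (auto simp: \<rho> field_simps)
  have "1 / 2 \<le> \<rho> ^ n"
    using Bernoulli_inequality[of "- (1 / (2 * real n))" n] n by (simp add: \<rho>)
  have "(norm (resolvent_series T p (of_real \<rho> * cis t) y))\<^sup>2
      \<le> (B * real n ^ p)\<^sup>2 * (norm (resolvent_series T 0 (of_real \<rho> * cis t) x))\<^sup>2" if "t \<in> {-pi..pi}" for t
    using power_mono[OF le[OF that], of 2] by (simp add: power_mult_distrib)
  from has_integral_le[OF resolvent_series_parseval(1)[OF \<rho>01] has_integral_mult_right[OF resolvent_series_parseval(1)[OF \<rho>01]] this]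
  have "(\<Sum>j. (real (j + p choose p) * \<rho> ^ j * norm ((T ^^ j) y))\<^sup>2)
      \<le> (B * real n ^ p)\<^sup>2 * (\<Sum>j. (real (j + 0 choose 0) * \<rho> ^ j * norm ((T ^^ j) x))\<^sup>2)"
    by simp
  also have "(\<Sum>j. (real (j + 0 choose 0) * \<rho> ^ j * norm ((T ^^ j) x))\<^sup>2) \<le> (\<Sum>j. \<rho> ^ j * (K * norm x)\<^sup>2)"
  proof (rule suminf_le[OF _ resolvent_series_parseval(2)[OF \<rho>01]])
    show "(real (j + 0 choose 0) * \<rho> ^ j * norm ((T ^^ j) x))\<^sup>2 \<le> \<rho> ^ j * (K * norm x)\<^sup>2" for j
    proof -
      have "(\<rho> ^ j)\<^sup>2 * (norm ((T ^^ j) x))\<^sup>2 \<le> \<rho> ^ j * (K * norm x)\<^sup>2"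
        using \<rho>01 norm_power_le[of j x]
        by (intro mult_mono power_mono) (auto simp: power2_eq_square mult_left_le power_le_one)
      then show ?thesis
        by (simp add: power_mult_distrib)
    qed
    show "summable (\<lambda>j. \<rho> ^ j * (K * norm x)\<^sup>2)"
      using \<rho>01 by (intro summable_mult2 summable_geometric) simp
  qed
  also have "(\<Sum>j. \<rho> ^ j * (K * norm x)\<^sup>2) = 2 * real n * (K * norm x)\<^sup>2"
    using \<rho>01 n by (subst suminf_mult2[symmetric]) (auto simp: suminf_geometric \<rho>)
  finally have upper: "(\<Sum>j. (real (j + p choose p) * \<rho> ^ j * norm ((T ^^ j) y))\<^sup>2)
      \<le> (B * real n ^ p)\<^sup>2 * (2 * real n * (K * norm x)\<^sup>2)"
    by (simp add: mult_left_mono)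
  \<comment> \<open>Every earlier power controls \<open>T ^^ n\<close>, so a single power is bounded
    by an average over j < n. The divisor \<open>2 * K * fact p\<close> collects the losses from
    \<open>\<rho> ^ j\<close>, power-boundedness and \<open>choose_ge\<close>.\<close>
  have lower: "(norm ((T ^^ n) y) / (2 * K * fact p))\<^sup>2 * real (Suc j) ^ (2 * p)
      \<le> (real (j + p choose p) * \<rho> ^ j * norm ((T ^^ j) y))\<^sup>2" if "j < n" for j
  proof -
    have "norm ((T ^^ n) y) \<le> K * norm ((T ^^ j) y)"
      using norm_power_le[of "n - j" "(T ^^ j) y"] that funpow_add[of "n - j" j T] by simp
    moreover have "1 / 2 \<le> \<rho> ^ j"
      using \<open>1 / 2 \<le> \<rho> ^ n\<close> power_decreasing[of j n \<rho>] that \<rho>01 by simp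
    moreover have "real (Suc j) ^ p / fact p \<le> real (j + p choose p)"
      using choose_ge[of j p] by (simp add: pos_divide_le_eq mult.commute del: of_nat_Suc)
    ultimately have "real (Suc j) ^ p / fact p * (1 / 2) * (norm ((T ^^ n) y) / K)
        \<le> real (j + p choose p) * \<rho> ^ j * norm ((T ^^ j) y)"
      using K \<rho>01 by (intro mult_mono) (auto simp: pos_divide_le_eq mult.commute)
    then have "norm ((T ^^ n) y) / (2 * K * fact p) * real (Suc j) ^ p
        \<le> real (j + p choose p) * \<rho> ^ j * norm ((T ^^ j) y)"
      by (simp add: ac_simps del: of_nat_Suc)
    from power_mono[OF this, of 2] show ?thesis
      using K by (simp only: power_mult_distrib[of _ "real (Suc j) ^ p"] power_even_eq) simp
  qed
  have "real n ^ Suc (2 * p) * ((norm ((T ^^ n) y) / (2 * K * fact p))\<^sup>2 / Suc (2 * p))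
      \<le> (norm ((T ^^ n) y) / (2 * K * fact p))\<^sup>2 * (\<Sum>j<n. real (Suc j) ^ (2 * p))"
    using mult_right_mono[OF sum_powers_ge[of n "2 * p"], of "(norm ((T ^^ n) y) / (2 * K * fact p))\<^sup>2 / Suc (2 * p)"]
    by (simp add: mult.commute del: of_nat_Suc power_Suc)
  also have "\<dots> = (\<Sum>j<n. (norm ((T ^^ n) y) / (2 * K * fact p))\<^sup>2 * real (Suc j) ^ (2 * p))"
    by (rule sum_distrib_left)
  also have "\<dots> \<le> (\<Sum>j. (real (j + p choose p) * \<rho> ^ j * norm ((T ^^ j) y))\<^sup>2)"
    using lower by (intro order_trans[OF sum_mono sum_le_suminf] resolvent_series_parseval(2)[OF \<rho>01]) auto
  also note upper
  also have "(B * real n ^ p)\<^sup>2 * (2 * real n * (K * norm x)\<^sup>2) = real n ^ Suc (2 * p) * (2 * (B * K * norm x)\<^sup>2)"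
    by (simp add: power_mult_distrib power_even_eq)
  finally have "(norm ((T ^^ n) y) / (2 * K * fact p))\<^sup>2 / Suc (2 * p) \<le> 2 * (B * K * norm x)\<^sup>2"
    using n by (simp only: mult_le_cancel_left_pos zero_less_power of_nat_0_less_iff)
  then have "(norm ((T ^^ n) y))\<^sup>2 \<le> 2 * (B * K * norm x)\<^sup>2 * Suc (2 * p) * (2 * K * fact p)\<^sup>2"
    using K by (simp add: power_divide pos_divide_le_eq mult_ac del: of_nat_Suc)
  also have "\<dots> = 8 * real (2 * p + 1) * (fact p * K\<^sup>2 * B * norm x)\<^sup>2"
    by (simp add: power_mult_distrib power2_eq_square)
  \<comment> \<open>With d = 2 p + 1, enlarging 8 d to the square of 4 d lets the square root be
    taken without radicals.\<close>
  also have "\<dots> \<le> (4 * real (2 * p + 1))\<^sup>2 * (fact p * K\<^sup>2 * B * norm x)\<^sup>2"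
    by (rule mult_right_mono[OF _ zero_le_power2]) (auto simp: power2_eq_square algebra_simps)
  finally have "(norm ((T ^^ n) y))\<^sup>2 \<le> (4 * real (2 * p + 1) * fact p * K\<^sup>2 * B * norm x)\<^sup>2"
    by (simp add: power_mult_distrib ac_simps)
  then show ?thesis
    by (rule power2_le_imp_le) (use B in simp)
qed

section \<open>The integrand near and away from the spectral point\<close>

text \<open>\<open>growth\<close> is the form in which positive increase enters. From
  \<open>1 \<le> \<epsilon> * m \<epsilon>\<close> and \<open>m \<epsilon> \<le> real n\<close>
  comes \<open>1 \<le> \<epsilon> * real n\<close>, so errors of relative size 1 / n are absorbed
  into \<epsilon>.\<close>

lemma norm_power_diff_le:
  fixes m :: "real \<Rightarrow> real"
  assumes n: "1 \<le> n" and \<epsilon>: "0 < \<epsilon>" "m \<epsilon> \<le> real n" "1 \<le> \<epsilon> * m \<epsilon>" and C: "1 \<le> C"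
    and m_pos: "\<And>\<theta>. \<theta> \<in> {0<..pi} \<Longrightarrow> 0 < m \<theta>"
    and R: "\<And>\<theta> w. 0 < \<bar>\<theta>\<bar> \<Longrightarrow> \<bar>\<theta>\<bar> \<le> pi \<Longrightarrow> norm w \<le> m \<bar>\<theta>\<bar> * norm (cis \<theta> *\<^sub>C w - T w)"
    and growth: "\<And>\<theta>. \<epsilon> \<le> \<theta> \<Longrightarrow> \<theta> \<le> pi \<Longrightarrow> \<theta> * m \<theta> ^ Suc p \<le> C * \<epsilon> * m \<epsilon> ^ Suc p"
  shows "norm ((T ^^ n) (x - T x))
    \<le> 4 * real (2 * Suc p + 1) * fact (Suc p) * K\<^sup>2 * (2 * (2 * K\<^sup>2) ^ Suc p * (2 + C) * \<epsilon>) * norm x"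
proof (rule norm_power_le_of_resolvent_series_le[OF n refl])
  define \<rho> where "\<rho> = 1 - 1 / (2 * real n)"
  have \<rho>: "1 / 2 \<le> \<rho>" "\<rho> < 1"
    using n by (auto simp: \<rho>_def field_simps)
  show "0 \<le> 2 * (2 * K\<^sup>2) ^ Suc p * (2 + C) * \<epsilon>"
    using C \<epsilon> by simp
  have m\<epsilon>: "0 < m \<epsilon>"
    using \<epsilon> by (smt (verit) mult_nonneg_nonpos)
  have \<epsilon>n: "1 \<le> \<epsilon> * real n"
    using \<epsilon> mult_left_mono[of "m \<epsilon>" "real n" \<epsilon>] by linarith
  have "2 * K \<le> 2 * K\<^sup>2"
    using K by (simp add: power2_eq_square)
  then have K_power: "(2 * K) ^ Suc p \<le> (2 * K\<^sup>2) ^ Suc p"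
    using K by (intro power_mono) auto
  fix t assume t: "t \<in> {-pi..pi}"
  define \<mu> where "\<mu> = of_real \<rho> * cis t"
  have norm_\<mu>: "cmod \<mu> = \<rho>"
    using \<rho> by (simp add: \<mu>_def norm_mult)
  \<comment> \<open>For \<open>\<epsilon> \<le> \<bar>t\<bar>\<close> both bounds are kept:
    \<open>m\<close> compensates the factor \<open>\<bar>t\<bar>\<close>, while \<open>n\<close>
    serves the terms without it. For \<open>\<bar>t\<bar> < \<epsilon>\<close>, which includes t = 0
    where \<open>R\<close> says nothing, power-boundedness suffices.\<close>
  define q where "q = (if \<bar>t\<bar> < \<epsilon> then 2 * real n * K else min (2 * real n * K) (2 * K\<^sup>2 * m \<bar>t\<bar>))"
  have "\<bar>t\<bar> < \<epsilon> \<or> 0 < m \<bar>t\<bar>"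
    using \<epsilon> t m_pos[of "\<bar>t\<bar>"] by force
  have q_le: "0 \<le> q" "q \<le> 2 * real n * K"
    using K \<open>\<bar>t\<bar> < \<epsilon> \<or> 0 < m \<bar>t\<bar>\<close> by (auto simp: q_def)
  have "norm w \<le> q * norm (w - \<mu> *\<^sub>C T w)" for w
  proof -
    have "norm w \<le> 2 * real n * K * norm (w - \<mu> *\<^sub>C T w)"
      using norm_le_one_minus[of \<mu> w] \<rho> by (simp add: norm_\<mu>) (simp add: \<rho>_def mult_ac)
    moreover have "norm w \<le> 2 * K\<^sup>2 * m \<bar>t\<bar> * norm (w - \<mu> *\<^sub>C T w)" if "\<epsilon> \<le> \<bar>t\<bar>"
      unfolding \<mu>_def
    proof (rule norm_le_one_minus_boundary)
      show "0 < m \<bar>t\<bar>"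
        using that \<epsilon> t by (intro m_pos) auto
      fix v
      \<comment> \<open>A rotation converts \<open>R\<close> at \<open>- t\<close> into the lower
        bound for I - cis t T that \<open>norm_le_one_minus_boundary\<close> expects.\<close>
      have "cis (- t) *\<^sub>C v - T v = cis (- t) *\<^sub>C (v - cis t *\<^sub>C T v)"
        by (simp add: linear_diff[OF bounded_linear.linear[OF bounded_linear_scaleC]] scaleC_scaleC cis_mult scaleC_one)
      then show "norm v \<le> m \<bar>t\<bar> * norm (v - cis t *\<^sub>C T v)"
        using R[of "- t" v] that \<epsilon> t by (simp only: norm_cis_scaleC) auto
    qed (use \<rho> in auto)
    ultimately show ?thesis
      by (auto simp: q_def min_def)
  qed
  from norm_resolvent_series_diff_le[OF _ q_le(1) this, of p x] \<rho>
  have "\<rho> * norm (resolvent_series T (Suc p) \<mu> (x - T x))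
      \<le> (q ^ p + cmod (1 - \<mu>) * q ^ Suc p) * norm (resolvent_series T 0 \<mu> x)"
    by (simp add: norm_\<mu>)
  \<comment> \<open>The left side splits into \<open>q ^ p\<close>, a radial part from 1 - \<rho>
    and a tangential part from \<open>t\<close>, bounded by 1, 1 and \<open>C\<close> times a common
    quantity; hence \<open>2 + C\<close>.\<close>
  moreover have "q ^ p + cmod (1 - \<mu>) * q ^ Suc p \<le> (2 * K\<^sup>2) ^ Suc p * (2 + C) * \<epsilon> * real n ^ Suc p"
  proof -
    have "q ^ Suc p \<le> (2 * real n * K) ^ Suc p"
      using q_le by (intro power_mono) auto
    also have "\<dots> = (2 * K) ^ Suc p * real n ^ Suc p"
      by (simp only: power_mult_distrib mult_ac)
    also have "\<dots> \<le> (2 * K\<^sup>2) ^ Suc p * real n ^ Suc p"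
      using K_power by (intro mult_right_mono) auto
    finally have q_Suc_le: "q ^ Suc p \<le> (2 * K\<^sup>2) ^ Suc p * real n ^ Suc p" .
    \<comment> \<open>Multiplying by \<open>\<epsilon> * real n\<close>, which is at least 1,
      supplies the missing power of \<open>n\<close> together with the desired factor
      \<epsilon>.\<close>
    have n_p: "(2 * K\<^sup>2) ^ Suc p * real n ^ p \<le> (2 * K\<^sup>2) ^ Suc p * \<epsilon> * real n ^ Suc p"
      using mult_left_mono[OF \<epsilon>n, of "(2 * K\<^sup>2) ^ Suc p * real n ^ p"] by (simp add: mult_ac)
    have "q ^ p \<le> (2 * real n * K) ^ p"
      using q_le by (intro power_mono) auto
    also have "\<dots> = (2 * K) ^ p * real n ^ p"
      by (simp only: power_mult_distrib mult_ac)
    also have "\<dots> \<le> (2 * K\<^sup>2) ^ Suc p * real n ^ p"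
    proof (rule mult_right_mono)
      have "(2 * K) ^ p \<le> (2 * K) ^ Suc p"
        using K by (intro power_increasing) auto
      with K_power show "(2 * K) ^ p \<le> (2 * K\<^sup>2) ^ Suc p"
        by linarith
    qed simp
    also note n_p
    finally have q_p: "q ^ p \<le> (2 * K\<^sup>2) ^ Suc p * \<epsilon> * real n ^ Suc p" .
    have "q ^ Suc p / (2 * real n) \<le> (2 * K\<^sup>2) ^ Suc p * real n ^ Suc p / (2 * real n)"
      by (rule divide_right_mono[OF q_Suc_le]) simp
    also have "\<dots> = (2 * K\<^sup>2) ^ Suc p * real n ^ p / 2"
      using n by (simp del: power_Suc add: power_Suc[of "real n"])
    also have "\<dots> \<le> (2 * K\<^sup>2) ^ Suc p * real n ^ p"
      by simp
    also note n_p
    finally have q_Suc: "q ^ Suc p / (2 * real n) \<le> (2 * K\<^sup>2) ^ Suc p * \<epsilon> * real n ^ Suc p" .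
    have t_q: "\<bar>t\<bar> * q ^ Suc p \<le> C * ((2 * K\<^sup>2) ^ Suc p * \<epsilon> * real n ^ Suc p)"
    proof (cases "\<bar>t\<bar> < \<epsilon>")
      case True
      then have "\<bar>t\<bar> * q ^ Suc p \<le> \<epsilon> * ((2 * K\<^sup>2) ^ Suc p * real n ^ Suc p)"
        using q_Suc_le q_le(1) \<epsilon> by (intro mult_mono) auto
      also have "\<dots> \<le> C * (\<epsilon> * ((2 * K\<^sup>2) ^ Suc p * real n ^ Suc p))"
        using C \<epsilon> mult_right_mono[of 1 C "\<epsilon> * ((2 * K\<^sup>2) ^ Suc p * real n ^ Suc p)"] by simp
      finally show ?thesis
        by (simp only: mult_ac)
    next
      case False
      then have "\<bar>t\<bar> * q ^ Suc p \<le> \<bar>t\<bar> * (2 * K\<^sup>2 * m \<bar>t\<bar>) ^ Suc p"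
        using q_le(1) by (intro mult_left_mono power_mono) (auto simp: q_def)
      also have "\<dots> = (2 * K\<^sup>2) ^ Suc p * (\<bar>t\<bar> * m \<bar>t\<bar> ^ Suc p)"
        by (simp only: power_mult_distrib mult_ac)
      also have "\<dots> \<le> (2 * K\<^sup>2) ^ Suc p * (C * \<epsilon> * real n ^ Suc p)"
      proof (rule mult_left_mono)
        have "C * \<epsilon> * m \<epsilon> ^ Suc p \<le> C * \<epsilon> * real n ^ Suc p"
          using C \<epsilon> m\<epsilon> by (intro mult_left_mono power_mono) auto
        moreover have "\<bar>t\<bar> * m \<bar>t\<bar> ^ Suc p \<le> C * \<epsilon> * m \<epsilon> ^ Suc p"
          by (rule growth) (use False t in auto)
        ultimately show "\<bar>t\<bar> * m \<bar>t\<bar> ^ Suc p \<le> C * \<epsilon> * real n ^ Suc p"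
          by linarith
      qed simp
      finally show ?thesis
        by (simp only: mult_ac)
    qed
    have "1 - \<mu> = of_real (1 - \<rho>) * cis t + (1 - cis t)"
      by (simp add: \<mu>_def algebra_simps)
    then have "cmod (1 - \<mu>) \<le> cmod (of_real (1 - \<rho>) * cis t) + cmod (1 - cis t)"
      by (simp only: norm_triangle_ineq)
    also have "\<dots> \<le> 1 / (2 * real n) + \<bar>t\<bar>"
      using cmod_cis_diff_1_le[of t] \<rho> unfolding norm_mult norm_of_real norm_cis
      by (simp add: norm_minus_commute) (simp add: \<rho>_def)
    finally have "cmod (1 - \<mu>) * q ^ Suc p \<le> q ^ Suc p / (2 * real n) + \<bar>t\<bar> * q ^ Suc p"
      using mult_right_mono[of "cmod (1 - \<mu>)" "1 / (2 * real n) + \<bar>t\<bar>" "q ^ Suc p"] q_le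
      by (simp add: distrib_right)
    moreover have "(2 * K\<^sup>2) ^ Suc p * (2 + C) * \<epsilon> * real n ^ Suc p
        = 2 * E + C * E" if "E = (2 * K\<^sup>2) ^ Suc p * \<epsilon> * real n ^ Suc p" for E
      unfolding that by (simp only: distrib_right distrib_left mult_ac)
    ultimately show ?thesis
      using q_p q_Suc t_q by force
  qed
  ultimately have "\<rho> * norm (resolvent_series T (Suc p) \<mu> (x - T x))
      \<le> (2 * K\<^sup>2) ^ Suc p * (2 + C) * \<epsilon> * real n ^ Suc p * norm (resolvent_series T 0 \<mu> x)"
    by (meson mult_right_mono norm_ge_zero order_trans)
  \<comment> \<open>Dividing by \<rho>, which is at least 1 / 2, accounts for the leading factor 2
    in the bound.\<close>
  moreover have "1 / 2 * norm (resolvent_series T (Suc p) \<mu> (x - T x)) \<le> \<rho> * norm (resolvent_series T (Suc p) \<mu> (x - T x))"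
    using \<rho> by (intro mult_right_mono) auto
  ultimately show "norm (resolvent_series T (Suc p) (of_real (1 - 1 / (2 * real n)) * cis t) (x - T x))
      \<le> 2 * (2 * K\<^sup>2) ^ Suc p * (2 + C) * \<epsilon> * real n ^ Suc p
        * norm (resolvent_series T 0 (of_real (1 - 1 / (2 * real n)) * cis t) x)"
    unfolding \<mu>_def \<rho>_def by linarith
qed

end

section \<open>Growth estimate from positive increase\<close>

text \<open>Positive increase at \<theta> with ratio t = \<theta> / \<epsilon> gives
  \<open>m \<epsilon> / m \<theta> \<ge> c * t powr \<alpha>\<close>. Once
  \<open>\<alpha> * (p + 1) \<ge> 1\<close>, the power p + 1 of this dominates the linear factor
  t.\<close>

lemma positive_increase_growth:
  assumes m_pos: "\<And>\<theta>. \<theta> \<in> {0<..pi} \<Longrightarrow> 0 < m \<theta>" and m_anti: "antimono_on {0<..pi} m"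
    and "reciprocally_positive_increase m"
  obtains p C \<epsilon>\<^sub>0 where "1 \<le> C" "0 < \<epsilon>\<^sub>0" "\<epsilon>\<^sub>0 \<le> pi"
    "\<forall>\<epsilon> \<theta>. 0 < \<epsilon> \<and> \<epsilon> \<le> \<epsilon>\<^sub>0 \<and> \<epsilon> \<le> \<theta> \<and> \<theta> \<le> pi \<longrightarrow> \<theta> * m \<theta> ^ Suc p \<le> C * \<epsilon> * m \<epsilon> ^ Suc p"
proof -
  obtain c \<alpha> \<epsilon>\<^sub>0 where c: "0 < c" "c \<le> 1" "0 < \<alpha>" and \<epsilon>\<^sub>0: "0 < \<epsilon>\<^sub>0" "\<epsilon>\<^sub>0 \<le> pi"
    and incr: "\<And>t \<epsilon>. 1 \<le> t \<Longrightarrow> 0 < \<epsilon> \<Longrightarrow> \<epsilon> \<le> \<epsilon>\<^sub>0 \<Longrightarrow> m (inverse t * \<epsilon>) / m \<epsilon> \<ge> c * t powr \<alpha>"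
    using assms(3) unfolding reciprocally_positive_increase_def by blast
  obtain p where "1 / \<alpha> < real p"
    using reals_Archimedean2 by blast
  then have p: "1 \<le> \<alpha> * real (Suc p)"
    using c by (simp add: field_simps)
  define C where "C = 1 / c ^ Suc p"
  have near: "\<theta> * m \<theta> ^ Suc p \<le> C * \<epsilon> * m \<epsilon> ^ Suc p" if \<epsilon>: "0 < \<epsilon>" "\<epsilon> \<le> \<theta>" "\<theta> \<le> \<epsilon>\<^sub>0" for \<epsilon> \<theta>
  proof -
    have m\<theta>: "0 < m \<theta>"
      using \<epsilon> \<epsilon>\<^sub>0 by (intro m_pos) auto
    have "c ^ Suc p * (\<theta> / \<epsilon>) \<le> c ^ Suc p * (\<theta> / \<epsilon>) powr (\<alpha> * real (Suc p))"
      using p c \<epsilon> powr_mono[of 1 "\<alpha> * real (Suc p)" "\<theta> / \<epsilon>"] by (intro mult_left_mono) auto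
    also have "\<dots> = (c * (\<theta> / \<epsilon>) powr \<alpha>) ^ Suc p"
      using \<epsilon> by (simp add: power_mult_distrib powr_power mult.commute del: of_nat_Suc power_Suc)
    also have "\<dots> \<le> (m \<epsilon> / m \<theta>) ^ Suc p"
      using incr[of "\<theta> / \<epsilon>" \<theta>] \<epsilon> c by (intro power_mono) auto
    finally have "c ^ Suc p * (\<theta> / \<epsilon>) * m \<theta> ^ Suc p \<le> m \<epsilon> ^ Suc p"
      using m\<theta> by (simp only: power_divide pos_le_divide_eq zero_less_power)
    then have "\<theta> * m \<theta> ^ Suc p * c ^ Suc p \<le> \<epsilon> * m \<epsilon> ^ Suc p"
      using \<epsilon> by (simp add: pos_divide_le_eq mult_ac del: power_Suc)
    then show ?thesis
      using c by (simp add: C_def pos_le_divide_eq del: power_Suc)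
  qed
  have "1 \<le> C"
    using c by (simp add: C_def power_le_one del: power_Suc)
  have "1 \<le> pi / \<epsilon>\<^sub>0"
    using \<epsilon>\<^sub>0 by simp
  show ?thesis
  proof (rule that[of "pi / \<epsilon>\<^sub>0 * C" \<epsilon>\<^sub>0 p])
    show "1 \<le> pi / \<epsilon>\<^sub>0 * C"
      using mult_mono[OF \<open>1 \<le> pi / \<epsilon>\<^sub>0\<close> \<open>1 \<le> C\<close>] \<epsilon>\<^sub>0 by simp
    show "\<forall>\<epsilon> \<theta>. 0 < \<epsilon> \<and> \<epsilon> \<le> \<epsilon>\<^sub>0 \<and> \<epsilon> \<le> \<theta> \<and> \<theta> \<le> pi \<longrightarrow> \<theta> * m \<theta> ^ Suc p \<le> pi / \<epsilon>\<^sub>0 * C * \<epsilon> * m \<epsilon> ^ Suc p"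
    proof (intro allI impI)
      fix \<epsilon> \<theta> assume "0 < \<epsilon> \<and> \<epsilon> \<le> \<epsilon>\<^sub>0 \<and> \<epsilon> \<le> \<theta> \<and> \<theta> \<le> pi"
      then have \<epsilon>: "0 < \<epsilon>" "\<epsilon> \<le> \<epsilon>\<^sub>0" "\<epsilon> \<le> \<theta>" "\<theta> \<le> pi"
        by auto
      have nonneg: "0 \<le> C * \<epsilon> * m \<epsilon> ^ Suc p"
        using \<epsilon> \<epsilon>\<^sub>0 \<open>1 \<le> C\<close> m_pos[of \<epsilon>] by simp
      have "\<theta> * m \<theta> ^ Suc p \<le> pi / \<epsilon>\<^sub>0 * (C * \<epsilon> * m \<epsilon> ^ Suc p)"
      proof (cases "\<theta> \<le> \<epsilon>\<^sub>0")
        case True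
        with near[of \<epsilon> \<theta>] \<epsilon> show ?thesis
          using mult_right_mono[OF \<open>1 \<le> pi / \<epsilon>\<^sub>0\<close> nonneg] by linarith
      next
        \<comment> \<open>Beyond \<open>\<epsilon>\<^sub>0\<close> monotonicity takes over: \<theta>
          is compared with \<open>\<epsilon>\<^sub>0\<close>, and \<open>\<theta> \<le> pi\<close>
          costs the factor \<open>pi / \<epsilon>\<^sub>0\<close>.\<close>
        case False
        have "m \<theta> \<le> m \<epsilon>\<^sub>0" "0 < m \<theta>"
          using False \<epsilon> \<epsilon>\<^sub>0 m_pos[of \<theta>] monotone_onD[OF m_anti, of \<epsilon>\<^sub>0 \<theta>] by auto
        then have "\<theta> * m \<theta> ^ Suc p \<le> pi / \<epsilon>\<^sub>0 * (\<epsilon>\<^sub>0 * m \<epsilon>\<^sub>0 ^ Suc p)"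
          using \<epsilon> \<epsilon>\<^sub>0 by (simp del: power_Suc) (intro mult_mono power_mono; simp)
        also have "\<dots> \<le> pi / \<epsilon>\<^sub>0 * (C * \<epsilon> * m \<epsilon> ^ Suc p)"
          using near[of \<epsilon> \<epsilon>\<^sub>0] \<epsilon> \<epsilon>\<^sub>0 by (intro mult_left_mono) auto
        finally show ?thesis .
      qed
      then show "\<theta> * m \<theta> ^ Suc p \<le> pi / \<epsilon>\<^sub>0 * C * \<epsilon> * m \<epsilon> ^ Suc p"
        by (simp only: mult.assoc)
    qed
  qed (use \<epsilon>\<^sub>0 in auto)
qed

section \<open>Resolvents and distance to the spectrum\<close>

text \<open>\<open>resolvent\<close> is a plain \<open>inv\<close>; uniqueness of two-sided inverses
  identifies it with the bounded operator provided by \<open>resolvent_set\<close>.\<close>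

lemma resolvent_eq:
  assumes "l \<in> resolvent_set T"
  shows "bounded_clinear (resolvent l T)" "resolvent l T (l *\<^sub>C w - T w) = w"
    "l *\<^sub>C resolvent l T w - T (resolvent l T w) = w"
proof -
  obtain S where S: "bounded_clinear S" "S \<circ> (\<lambda>x. l *\<^sub>C x - T x) = id" "(\<lambda>x. l *\<^sub>C x - T x) \<circ> S = id"
    using assms unfolding resolvent_set_def by blast
  from S(2,3) have "resolvent l T = S"
    unfolding resolvent_def by (metis inv_unique_comp)
  then show "bounded_clinear (resolvent l T)" "resolvent l T (l *\<^sub>C w - T w) = w"
    "l *\<^sub>C resolvent l T w - T (resolvent l T w) = w"
    using S by (simp, metis comp_apply id_apply, metis comp_apply id_apply)
qed

lemma norm_le_onorm_resolvent:
  assumes "l \<in> resolvent_set T"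
  shows "norm w \<le> onorm (resolvent l T) * norm (l *\<^sub>C w - T w)"
  using onorm[of "resolvent l T" "l *\<^sub>C w - T w"] resolvent_eq[OF assms]
  by (simp add: bounded_clinear_def)

text \<open>The Neumann series argument, with the fixed-point theorem in place of the series.\<close>

lemma onorm_resolvent_dist_spectrum:
  fixes T :: "'a :: complex_hilbert_space \<Rightarrow> 'a"
  assumes T: "bounded_clinear T" and l: "l \<in> resolvent_set T" and k: "k \<notin> resolvent_set T"
  shows "1 \<le> onorm (resolvent l T) * cmod (l - k)"
proof (rule ccontr)
  define S where "S = resolvent l T"
  define q where "q = onorm S * cmod (l - k)"
  define A where "A w = k *\<^sub>C w - T w" for w
  assume "\<not> ?thesis"
  then have "q < 1"
    by (simp add: q_def S_def)
  have S: "bounded_linear S"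
    using resolvent_eq(1)[OF l] by (simp add: S_def bounded_clinear_def)
  have "0 \<le> q"
    by (simp add: q_def onorm_pos_le[OF S])
  \<comment> \<open>The equation k w - T w = y is the same as l w - T w = y + (l - k) w, so its
    solutions are the fixed points of a map with Lipschitz constant \<open>q\<close>.\<close>
  have fixpoint: "S (y + (l - k) *\<^sub>C w) = w \<longleftrightarrow> A w = y" for w y
  proof -
    have "S (y + (l - k) *\<^sub>C w) = w \<longleftrightarrow> y + (l - k) *\<^sub>C w = l *\<^sub>C w - T w"
      unfolding S_def using resolvent_eq(2,3)[OF l] by metis
    then show ?thesis
      by (auto simp: A_def scaleC_diff_left algebra_simps)
  qed
  have unique: "\<exists>!w. A w = y" for y
    unfolding fixpoint[symmetric]
  proof (rule banach_fix_type[OF \<open>0 \<le> q\<close> \<open>q < 1\<close>], intro allI)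
    fix v w
    have "S (y + (l - k) *\<^sub>C v) - S (y + (l - k) *\<^sub>C w) = S ((l - k) *\<^sub>C (v - w))"
      by (simp add: linear_diff[OF bounded_linear.linear[OF bounded_linear_scaleC]]
          flip: linear_diff[OF bounded_linear.linear[OF S]])
    then show "dist (S (y + (l - k) *\<^sub>C v)) (S (y + (l - k) *\<^sub>C w)) \<le> q * dist v w"
      using onorm[OF S, of "(l - k) *\<^sub>C (v - w)"] by (simp add: dist_norm norm_scaleC q_def mult.assoc)
  qed
  then have A_inv: "A (inv A y) = y" and inv_A: "inv A (A y) = y" for y
    using bij_def[of A] by (metis surj_def surj_f_inv_f, metis injI inv_f_f)
  have A_add: "A (x + y) = A x + A y" and A_scaleC: "A (a *\<^sub>C x) = a *\<^sub>C A x" for x y a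
    using T by (simp_all add: A_def bounded_clinear_def scaleC_add_right scaleC_scaleC mult.commute
        linear_add[OF bounded_linear.linear] linear_diff[OF bounded_linear.linear[OF bounded_linear_scaleC]])
  have inv_scaleC: "inv A (a *\<^sub>C y) = a *\<^sub>C inv A y" for a y
    by (metis A_inv inv_A A_scaleC)
  \<comment> \<open>The constant comes from solving
    \<open>norm w \<le> onorm S * norm y + q * norm w\<close> for the fixed point
    \<open>w = inv A y\<close>.\<close>
  have "bounded_linear (inv A)"
  proof (rule bounded_linear_intro[where K = "onorm S / (1 - q)"])
    show "inv A (x + y) = inv A x + inv A y" for x y
      by (metis A_inv inv_A A_add)
    show "inv A (r *\<^sub>R y) = r *\<^sub>R inv A y" for r y
      by (simp add: scaleR_scaleC inv_scaleC)
    show "norm (inv A y) \<le> norm y * (onorm S / (1 - q))" for y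
    proof -
      have "norm (inv A y) \<le> onorm S * norm (y + (l - k) *\<^sub>C inv A y)"
        using onorm[OF S, of "y + (l - k) *\<^sub>C inv A y"] fixpoint[of y "inv A y"] A_inv by simp
      also have "\<dots> \<le> onorm S * (norm y + cmod (l - k) * norm (inv A y))"
        by (intro mult_left_mono onorm_pos_le[OF S]) (metis norm_scaleC norm_triangle_ineq)
      finally have "(1 - q) * norm (inv A y) \<le> onorm S * norm y"
        by (simp add: q_def algebra_simps)
      then show ?thesis
        using \<open>q < 1\<close> by (simp add: field_simps)
    qed
  qed
  then have "bounded_clinear (inv A)"
    by (simp add: bounded_clinear_def inv_scaleC)
  moreover have "inv A \<circ> A = id" "A \<circ> inv A = id"
    by (auto simp: fun_eq_iff A_inv inv_A)
  ultimately have "k \<in> resolvent_set T"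
    unfolding resolvent_set_def A_def by blast
  with k show False ..
qed

section \<open>Operator norms and the final estimate\<close>

lemma bounded_linear_funpow:
  fixes T :: "'a :: real_normed_vector \<Rightarrow> 'a"
  shows "bounded_linear T \<Longrightarrow> bounded_linear (T ^^ n)"
  by (induction n) (auto simp: id_def o_def intro: bounded_linear_ident bounded_linear_compose[of T])

lemma power_bounded_norm_le:
  assumes "bounded_linear T" "power_bounded T"
  obtains K where "1 \<le> K" "\<forall>n x. norm ((T ^^ n) x) \<le> K * norm x"
proof -
  obtain K where K: "\<And>n. onorm (T ^^ n) \<le> K"
    using assms(2) unfolding power_bounded_def bdd_above_def by auto
  show ?thesis
  proof (rule that[of "max 1 K"], simp, intro allI)
    fix n x
    have "norm ((T ^^ n) x) \<le> onorm (T ^^ n) * norm x"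
      by (intro onorm bounded_linear_funpow assms)
    also have "\<dots> \<le> max 1 K * norm x"
      using K[of n] by (intro mult_right_mono) auto
    finally show "norm ((T ^^ n) x) \<le> max 1 K * norm x" .
  qed
qed

text \<open>
  It suffices to bound the norm by \<open>D * \<epsilon>\<close> for every \<open>\<epsilon>\<close> with \<open>m \<epsilon> \<le> n\<close>, so it does not matter
  whether the infimum defining the right inverse is attained.
\<close>

theorem theorem2p3:
  fixes T :: "'a :: complex_hilbert_space \<Rightarrow> 'a"
    and m :: "real \<Rightarrow> real"
  assumes "bounded_clinear T"
    and "power_bounded T"
    and "op_spectrum T \<inter> {l. cmod l = 1} = {1}"
    and "\<And>\<epsilon>. \<epsilon> \<in> {0<..pi} \<Longrightarrow> 0 < m \<epsilon>"
    and "continuous_on {0<..pi} m"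
    and "antimono_on {0<..pi} m"
    and "reciprocally_positive_increase m"
    and "\<And>\<theta>. 0 < \<bar>\<theta>\<bar> \<Longrightarrow> \<bar>\<theta>\<bar> \<le> pi \<Longrightarrow>
           onorm (resolvent (exp (\<i> * complex_of_real \<theta>)) T) \<le> m \<bar>\<theta>\<bar>"
  shows "(\<lambda>n :: nat. onorm ((T ^^ n) \<circ> (\<lambda>x. x - T x))) \<in> O(\<lambda>n. right_inverse m (real n))"
proof -
  have T_linear: "bounded_linear T"
    using assms(1) by (simp add: bounded_clinear_def)
  obtain K where K: "1 \<le> K" and norm_power_le: "\<forall>n x. norm ((T ^^ n) x) \<le> K * norm x"
    by (rule power_bounded_norm_le[OF T_linear assms(2)])
  obtain p C \<epsilon>\<^sub>0 where C: "1 \<le> C" and \<epsilon>\<^sub>0: "0 < \<epsilon>\<^sub>0" "\<epsilon>\<^sub>0 \<le> pi"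
    and growth: "\<forall>\<epsilon> \<theta>. 0 < \<epsilon> \<and> \<epsilon> \<le> \<epsilon>\<^sub>0 \<and> \<epsilon> \<le> \<theta> \<and> \<theta> \<le> pi \<longrightarrow> \<theta> * m \<theta> ^ Suc p \<le> C * \<epsilon> * m \<epsilon> ^ Suc p"
    by (rule positive_increase_growth[OF assms(4,6,7)])
  have resolvent_set: "cis \<theta> \<in> resolvent_set T" if \<theta>: "0 < \<bar>\<theta>\<bar>" "\<bar>\<theta>\<bar> \<le> pi" for \<theta>
  proof -
    have "cis \<theta> \<noteq> 1"
      using \<theta> cis_eq_1_imp_zero[of \<theta>] by fastforce
    then have "cis \<theta> \<notin> op_spectrum T \<inter> {l. cmod l = 1}"
      unfolding assms(3) by simp
    then show ?thesis
      by (simp add: op_spectrum_def)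
  qed
  have onorm_le: "onorm (resolvent (cis \<theta>) T) \<le> m \<bar>\<theta>\<bar>" if "0 < \<bar>\<theta>\<bar>" "\<bar>\<theta>\<bar> \<le> pi" for \<theta>
    using assms(8)[OF that] by (simp add: cis_conv_exp)
  have R: "norm w \<le> m \<bar>\<theta>\<bar> * norm (cis \<theta> *\<^sub>C w - T w)" if "0 < \<bar>\<theta>\<bar>" "\<bar>\<theta>\<bar> \<le> pi" for \<theta> w
    using norm_le_onorm_resolvent[OF resolvent_set[OF that]] onorm_le[OF that]
    by (meson mult_right_mono norm_ge_zero order_trans)
  have "1 \<notin> resolvent_set T"
    using assms(3) unfolding op_spectrum_def by blast
  \<comment> \<open>As 1 lies in the spectrum, the resolvent norm at \<open>cis \<epsilon>\<close>
    is at least the reciprocal of the distance to 1, and that distance is at most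
    \<epsilon>.\<close>
  have lower: "1 \<le> \<epsilon> * m \<epsilon>" if "\<epsilon> \<in> {0<..pi}" for \<epsilon>
  proof -
    have "1 \<le> onorm (resolvent (cis \<epsilon>) T) * cmod (cis \<epsilon> - 1)"
      using that by (intro onorm_resolvent_dist_spectrum resolvent_set \<open>1 \<notin> resolvent_set T\<close> assms(1)) auto
    also have "\<dots> \<le> m \<epsilon> * \<epsilon>"
      using that onorm_le[of \<epsilon>] cmod_cis_diff_1_le[of \<epsilon>] assms(4)[of \<epsilon>] by (intro mult_mono) auto
    finally show ?thesis
      by (simp add: mult.commute)
  qed
  define D where "D = 4 * real (2 * Suc p + 1) * fact (Suc p) * K\<^sup>2 * (2 * (2 * K\<^sup>2) ^ Suc p * (2 + C))"
  have "0 < D"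
    using K C unfolding D_def by (intro mult_pos_pos zero_less_power add_pos_pos) auto
  have bound: "onorm ((T ^^ n) \<circ> (\<lambda>x. x - T x)) \<le> D * \<epsilon>"
    if "1 \<le> n" "0 < \<epsilon>" "\<epsilon> \<le> \<epsilon>\<^sub>0" "m \<epsilon> \<le> real n" for n \<epsilon>
  proof (rule onorm_bound)
    show "0 \<le> D * \<epsilon>"
      using \<open>0 < D\<close> that by simp
    show "norm (((T ^^ n) \<circ> (\<lambda>x. x - T x)) x) \<le> D * \<epsilon> * norm x" for x
    proof -
      have "norm ((T ^^ n) (x - T x))
          \<le> 4 * real (2 * Suc p + 1) * fact (Suc p) * K\<^sup>2 * (2 * (2 * K\<^sup>2) ^ Suc p * (2 + C) * \<epsilon>) * norm x"
        using that \<epsilon>\<^sub>0 norm_power_le growth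
        by (intro norm_power_diff_le[where m = m] assms(1,4) K C R lower) auto
      then show ?thesis
        by (simp add: D_def mult.assoc)
    qed
  qed
  show ?thesis
  proof (rule bigoI[where c = D])
    \<comment> \<open>Once \<open>m \<epsilon>\<^sub>0 \<le> real n\<close>, the point
      \<open>\<epsilon>\<^sub>0\<close> itself is admissible, so the infimum is over a nonempty
      set.\<close>
    have "\<forall>\<^sub>F n in sequentially. 1 \<le> n \<and> m \<epsilon>\<^sub>0 \<le> real n"
      using eventually_ge_at_top[of "max 1 (nat \<lceil>m \<epsilon>\<^sub>0\<rceil>)"]
      by eventually_elim (auto simp: nat_le_iff ceiling_le_iff)
    then show "\<forall>\<^sub>F n in sequentially. norm (onorm ((T ^^ n) \<circ> (\<lambda>x. x - T x))) \<le> D * norm (right_inverse m (real n))"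
    proof eventually_elim
      case (elim n)
      let ?c = "onorm ((T ^^ n) \<circ> (\<lambda>x. x - T x))"
      \<comment> \<open>For \<epsilon> beyond \<open>\<epsilon>\<^sub>0\<close> the bound at
        \<open>\<epsilon>\<^sub>0\<close> is already stronger.\<close>
      have "?c / D \<le> \<epsilon>" if "\<epsilon> \<in> {0<..pi}" "m \<epsilon> \<le> real n" for \<epsilon>
        using bound[of n \<epsilon>] bound[of n \<epsilon>\<^sub>0] elim that \<epsilon>\<^sub>0 \<open>0 < D\<close>
        by (cases "\<epsilon> \<le> \<epsilon>\<^sub>0") (auto simp: pos_divide_le_eq mult.commute intro: order_trans)
      then have "?c / D \<le> right_inverse m (real n)"
        unfolding right_inverse_def using elim \<epsilon>\<^sub>0 by (intro cInf_greatest) auto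
      then have "?c \<le> D * right_inverse m (real n)"
        using \<open>0 < D\<close> by (simp add: pos_divide_le_eq mult.commute)
      moreover have "0 \<le> ?c"
        using T_linear by (intro onorm_pos_le bounded_linear_compose[unfolded o_def[symmetric]]
            bounded_linear_funpow bounded_linear_sub bounded_linear_ident)
      moreover have "D * right_inverse m (real n) \<le> D * \<bar>right_inverse m (real n)\<bar>"
        using \<open>0 < D\<close> by (intro mult_left_mono) auto
      ultimately show ?case
        by (simp only: real_norm_def)
    qed
  qed
qed

end
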